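(* The inclusions $c_{0}\subset c_{0}(\widehat{F})$ and $c\subset c(\widehat{F})$ hold and both are strict.
   Context: Let $\mathbb{N}=\{0,1,2,\dots\}$ and let $\omega$ be the vector space of all real sequences $x=(x_k)_{k\in\mathbb{N}}$. The Fibonacci numbers are defined by $f_0=f_1=1$ and $f_n=f_{n-1}+f_{n-2}$ for $n\ge 2$. For $x\in\omega$ the $\widehat{F}$-transform $\widehat{F}x=(\widehat{F}_n(x))_{n\in\mathbb{N}}$ is defined by $\widehat{F}_0(x)=x_0$ and $\widehat{F}_n(x)=\frac{f_n}{f_{n+1}}x_n-\frac{f_{n+1}}{f_n}x_{n-1}$ for $n\ge1$. Let $c_0$ and $c$ be the spaces of null and of convergent sequences, and put $c_0(\widehat{F})=\{x\in\omega:\widehat{F}x\in c_0\}$ and $c(\widehat{F})=\{x\in\omega:\widehat{F}x\in c\}$. *)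

theory Defs
  imports Complex_Main "HOL-Number_Theory.Fib"
begin

(* Fibonacci numbers normalised by f 0 = f 1 = 1, whereas the library has fib 0 = 0. *)
definition fibo :: "nat \<Rightarrow> real" where
  "fibo n = real (fib (Suc n))"

lemma fibo_0: "fibo 0 = 1"
  by (simp add: fibo_def)

lemma fibo_1: "fibo 1 = 1"
  by (simp add: fibo_def)

lemma fibo_rec: "n \<ge> 2 \<Longrightarrow> fibo n = fibo (n - 1) + fibo (n - 2)"
  by (cases n rule: fib.cases) (simp_all add: fibo_def)

definition Fhat :: "(nat \<Rightarrow> real) \<Rightarrow> nat \<Rightarrow> real" where
  "Fhat x n = (if n = 0 then x 0
     else fibo n / fibo (n + 1) * x n - fibo (n + 1) / fibo n * x (n - 1))"

definition null_seqs :: "(nat \<Rightarrow> real) set" where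
  "null_seqs = {x. x \<longlonglongrightarrow> 0}"

definition conv_seqs :: "(nat \<Rightarrow> real) set" where
  "conv_seqs = {x. convergent x}"

definition null_seqs_Fhat :: "(nat \<Rightarrow> real) set" where
  "null_seqs_Fhat = {x. Fhat x \<in> null_seqs}"

definition conv_seqs_Fhat :: "(nat \<Rightarrow> real) set" where
  "conv_seqs_Fhat = {x. Fhat x \<in> conv_seqs}"

end

theory Submission
  imports Defs
begin

text \<open>
  Write \<open>r n = fibo (n + 1) / fibo n\<close>, so that for \<open>n \<ge> 1\<close> the transform reads
  \<open>Fhat x n = x n / r n - r n * x (n - 1)\<close>. The ratio \<open>r n\<close> tends to the golden ratio \<open>\<phi>\<close>,
  hence \<open>x \<longlonglongrightarrow> l\<close> forces \<open>Fhat x \<longlonglongrightarrow> (1 / \<phi> - \<phi>) * l\<close>; this gives both inclusions at once, the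
  first being the case \<open>l = 0\<close>.

  Both inclusions are strict because of a single sequence. Solving the recurrence
  \<open>Fhat x n = 0\<close> for \<open>n \<ge> 1\<close> means \<open>x n = (r n)\<^sup>2 * x (n - 1)\<close>, which telescopes to
  \<open>x n = (fibo (n + 1))\<^sup>2\<close> when \<open>x 0 = 1\<close>. This sequence diverges, because no positive limit
  is compatible with the Fibonacci recurrence and a sequence of positive integers cannot tend
  to \<open>0\<close>, while its transform is
  \<open>(1, 0, 0, \<dots>)\<close>.
\<close>

lemma fibo_pos: "fibo n > 0"
  by (simp add: fibo_def fib_neq_0_nat)

text \<open>By Binet's formula \<open>fib n\<close> is asymptotic to \<open>\<phi> ^ n / sqrt 5\<close>; in the ratio of consecutive
  terms the constant \<open>1 / sqrt 5\<close> cancels and one factor \<open>\<phi>\<close> remains.\<close>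

lemma fibo_ratio_tendsto_golden_ratio:
  "(\<lambda>n. fibo (Suc n) / fibo n) \<longlonglongrightarrow> (1 + sqrt 5) / 2"
proof -
  define \<phi> :: real where "\<phi> = (1 + sqrt 5) / 2"
  define q where "q = (\<lambda>n. real (fib n) / (\<phi> ^ n / sqrt 5))"
  have \<phi>: "\<phi> > 0"
    by (simp add: \<phi>_def add_pos_pos)
  have "q \<longlonglongrightarrow> 1"
    unfolding q_def \<phi>_def by (rule fib_asymptotics)
  then have "(\<lambda>n. \<phi> * (q (Suc (Suc n)) / q (Suc n))) \<longlonglongrightarrow> \<phi> * (1 / 1)"
    by (intro tendsto_intros LIMSEQ_Suc) auto
  also have "(\<lambda>n. \<phi> * (q (Suc (Suc n)) / q (Suc n))) = (\<lambda>n. fibo (Suc n) / fibo n)"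
    using \<phi> by (simp add: q_def fibo_def field_simps del: fib.simps)
  finally show ?thesis
    by (simp add: \<phi>_def)
qed

lemma Fhat_tendsto:
  assumes "x \<longlonglongrightarrow> l"
  shows "Fhat x \<longlonglongrightarrow> (1 / ((1 + sqrt 5) / 2) - (1 + sqrt 5) / 2) * l"
proof -
  let ?\<phi> = "(1 + sqrt 5) / 2 :: real"
  let ?r = "\<lambda>n. fibo (Suc n) / fibo n"
  have \<phi>: "?\<phi> \<noteq> 0"
    using add_pos_pos[of 1 "sqrt 5"] by simp
  have "(\<lambda>n. 1 / ?r (Suc n) * x (Suc n) - ?r (Suc n) * x n) \<longlonglongrightarrow> 1 / ?\<phi> * l - ?\<phi> * l"
    by (rule tendsto_diff tendsto_mult tendsto_divide tendsto_const \<phi> assms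
          LIMSEQ_Suc[OF fibo_ratio_tendsto_golden_ratio] LIMSEQ_Suc[OF assms])+
  then have "(\<lambda>n. Fhat x (Suc n)) \<longlonglongrightarrow> (1 / ?\<phi> - ?\<phi>) * l"
    by (simp add: Fhat_def left_diff_distrib)
  then show ?thesis
    by (rule LIMSEQ_imp_Suc)
qed

lemma Fhat_fibo_square: "Fhat (\<lambda>n. (fibo (Suc n))\<^sup>2) n = (if n = 0 then 1 else 0)"
  using fibo_pos[of n] fibo_pos[of "Suc n"]
  by (auto simp: Fhat_def fibo_1 [simplified] power2_eq_square)

lemma Fhat_fibo_square_tendsto_0: "Fhat (\<lambda>n. (fibo (Suc n))\<^sup>2) \<longlonglongrightarrow> 0"
  by (rule LIMSEQ_imp_Suc) (simp add: Fhat_fibo_square)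

text \<open>If the squares converged to \<open>l\<close>, then \<open>fibo (Suc n)\<close>, being nonnegative, would converge to
  \<open>s = sqrt l\<close>, and the Fibonacci recurrence would give \<open>s = s + s\<close>. But \<open>s = 0\<close> is impossible for
  a sequence of positive integers.\<close>

lemma not_convergent_fibo_square: "\<not> convergent (\<lambda>n. (fibo (Suc n))\<^sup>2)"
proof
  assume "convergent (\<lambda>n. (fibo (Suc n))\<^sup>2)"
  then obtain l where "(\<lambda>n. (fibo (Suc n))\<^sup>2) \<longlonglongrightarrow> l"
    by (auto simp: convergent_def)
  then have "(\<lambda>n. sqrt ((fibo (Suc n))\<^sup>2)) \<longlonglongrightarrow> sqrt l"
    by (rule tendsto_real_sqrt)
  then obtain s where "(\<lambda>n. fibo (Suc n)) \<longlonglongrightarrow> s"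
    using fibo_pos by (auto simp: less_imp_le)
  then have s: "fibo \<longlonglongrightarrow> s"
    by (rule LIMSEQ_imp_Suc)
  have "(\<lambda>n. fibo (Suc n) + fibo n) \<longlonglongrightarrow> s + s"
    by (intro tendsto_add LIMSEQ_Suc s)
  moreover have "(\<lambda>n. fibo (Suc n) + fibo n) = (\<lambda>n. fibo (Suc (Suc n)))"
    by (simp add: fibo_rec)
  ultimately have "s + s = s"
    using LIMSEQ_unique LIMSEQ_Suc[OF LIMSEQ_Suc[OF s]] by fastforce
  moreover have "fibo n \<ge> 1" for n
    using fib_neq_0_nat[of "Suc n"] by (simp add: fibo_def del: fib.simps)
  then have "s \<ge> 1"
    by (intro LIMSEQ_le_const[OF s]) auto
  ultimately show False
    by simp
qed

theorem theorem3p6: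
  shows "null_seqs \<subset> null_seqs_Fhat \<and> conv_seqs \<subset> conv_seqs_Fhat"
proof -
  let ?x = "\<lambda>n. (fibo (Suc n))\<^sup>2"
  have "null_seqs \<subseteq> null_seqs_Fhat"
    using Fhat_tendsto[where l = 0] by (auto simp: null_seqs_def null_seqs_Fhat_def)
  moreover have "conv_seqs \<subseteq> conv_seqs_Fhat"
    using Fhat_tendsto by (force simp: conv_seqs_def conv_seqs_Fhat_def convergent_def)
  moreover have "?x \<in> null_seqs_Fhat" "?x \<in> conv_seqs_Fhat"
    using Fhat_fibo_square_tendsto_0
    by (auto simp: null_seqs_def null_seqs_Fhat_def conv_seqs_def conv_seqs_Fhat_def convergent_def)
  moreover have "?x \<notin> null_seqs" "?x \<notin> conv_seqs"
    using not_convergent_fibo_square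
    by (auto simp: null_seqs_def conv_seqs_def convergent_def)
  ultimately show ?thesis
    by blast
qed

end
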